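(* Let $\mathcal{C}$ be a preregular category. The regular topology on $\mathcal{C}$ is subcanonical, i.e. for every object $W$ of $\mathcal{C}$ the representable presheaf $\operatorname{Hom}_{\mathcal{C}}(-,W)$ is a sheaf for the regular topology.
   Context: A morphism $f\colon Y\to X$ is an effective epimorphism if for every $e\colon Y\to W$ such that $e\circ g_1=e\circ g_2$ for all $g_1,g_2\colon Z\to Y$ with $f\circ g_1=f\circ g_2$, there is a unique $d\colon X\to W$ with $d\circ f=e$. A category is preregular if for every effective epimorphism $g\colon Z\to Y$ and every morphism $f\colon X\to Y$ there exist an effective epimorphism $h\colon W\to X$ and a morphism $i\colon W\to Z$ with $g\circ i=f\circ h$. The regular topology on a preregular category is the smallest Grothendieck topology in which, for each effective epimorphism $f$, the sieve generated by $f$ is a covering sieve. *)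

theory Defs
  imports Main
begin

record ('o, 'm) cat =
  Ob :: "'o set"
  Ar :: "'m set"
  Dom :: "'m \<Rightarrow> 'o"
  Cod :: "'m \<Rightarrow> 'o"
  Id :: "'o \<Rightarrow> 'm"
  Comp :: "'m \<Rightarrow> 'm \<Rightarrow> 'm"  (infixr "\<cdot>\<index>" 70)

text \<open>Composition is in the usual order: \<open>g \<cdot>\<^bsub>C\<^esub> f\<close> is meaningful if \<open>Cod C f = Dom C g\<close>.\<close>

definition Hom :: "('o, 'm) cat \<Rightarrow> 'o \<Rightarrow> 'o \<Rightarrow> 'm set" where
  "Hom C X Y = {f \<in> Ar C. Dom C f = X \<and> Cod C f = Y}"

locale category =
  fixes C :: "('o, 'm) cat" (structure)
  assumes Dom_in_Ob: "f \<in> Ar C \<Longrightarrow> Dom C f \<in> Ob C"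
    and Cod_in_Ob: "f \<in> Ar C \<Longrightarrow> Cod C f \<in> Ob C"
    and Id_in_Hom: "X \<in> Ob C \<Longrightarrow> Id C X \<in> Hom C X X"
    and Comp_in_Hom: "f \<in> Hom C X Y \<Longrightarrow> g \<in> Hom C Y Z \<Longrightarrow> g \<cdot> f \<in> Hom C X Z"
    and Comp_Id_left: "f \<in> Hom C X Y \<Longrightarrow> Id C Y \<cdot> f = f"
    and Comp_Id_right: "f \<in> Hom C X Y \<Longrightarrow> f \<cdot> Id C X = f"
    and Comp_assoc: "f \<in> Hom C X Y \<Longrightarrow> g \<in> Hom C Y Z \<Longrightarrow> h \<in> Hom C Z W \<Longrightarrow>
          (h \<cdot> g) \<cdot> f = h \<cdot> (g \<cdot> f)"

definition effective_epi :: "('o, 'm) cat \<Rightarrow> 'm \<Rightarrow> bool" where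
  "effective_epi C f \<longleftrightarrow> f \<in> Ar C \<and>
     (\<forall>W \<in> Ob C. \<forall>e \<in> Hom C (Dom C f) W.
        (\<forall>Z \<in> Ob C. \<forall>g1 \<in> Hom C Z (Dom C f). \<forall>g2 \<in> Hom C Z (Dom C f).
            f \<cdot>\<^bsub>C\<^esub> g1 = f \<cdot>\<^bsub>C\<^esub> g2 \<longrightarrow> e \<cdot>\<^bsub>C\<^esub> g1 = e \<cdot>\<^bsub>C\<^esub> g2) \<longrightarrow>
        (\<exists>!d. d \<in> Hom C (Cod C f) W \<and> d \<cdot>\<^bsub>C\<^esub> f = e))"

locale preregular_category = category +
  assumes preregular:
    "effective_epi C g \<Longrightarrow> g \<in> Hom C Z Y \<Longrightarrow> f \<in> Hom C X Y \<Longrightarrow>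
       \<exists>W \<in> Ob C. \<exists>h \<in> Hom C W X. \<exists>i \<in> Hom C W Z. effective_epi C h \<and> g \<cdot> i = f \<cdot> h"

definition sieve :: "('o, 'm) cat \<Rightarrow> 'o \<Rightarrow> 'm set \<Rightarrow> bool" where
  "sieve C X S \<longleftrightarrow> S \<subseteq> {f \<in> Ar C. Cod C f = X} \<and>
     (\<forall>f \<in> S. \<forall>g \<in> Ar C. Cod C g = Dom C f \<longrightarrow> f \<cdot>\<^bsub>C\<^esub> g \<in> S)"

definition maximal_sieve :: "('o, 'm) cat \<Rightarrow> 'o \<Rightarrow> 'm set" where
  "maximal_sieve C X = {f \<in> Ar C. Cod C f = X}"

definition pullback_sieve :: "('o, 'm) cat \<Rightarrow> 'm \<Rightarrow> 'm set \<Rightarrow> 'm set" where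
  "pullback_sieve C f S = {g \<in> Ar C. Cod C g = Dom C f \<and> f \<cdot>\<^bsub>C\<^esub> g \<in> S}"

definition generated_sieve :: "('o, 'm) cat \<Rightarrow> 'm \<Rightarrow> 'm set" where
  "generated_sieve C f = {f \<cdot>\<^bsub>C\<^esub> g | g. g \<in> Ar C \<and> Cod C g = Dom C f}"

text \<open>\<open>J X\<close> is the set of covering sieves on \<open>X\<close>; it is constrained only for objects \<open>X\<close>.\<close>

definition grothendieck_topology :: "('o, 'm) cat \<Rightarrow> ('o \<Rightarrow> 'm set set) \<Rightarrow> bool" where
  "grothendieck_topology C J \<longleftrightarrow>
     (\<forall>X \<in> Ob C. \<forall>S \<in> J X. sieve C X S) \<and>
     (\<forall>X \<in> Ob C. maximal_sieve C X \<in> J X) \<and>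
     (\<forall>f \<in> Ar C. \<forall>S \<in> J (Cod C f). pullback_sieve C f S \<in> J (Dom C f)) \<and>
     (\<forall>X \<in> Ob C. \<forall>S \<in> J X. \<forall>R. sieve C X R \<longrightarrow>
        (\<forall>f \<in> S. pullback_sieve C f R \<in> J (Dom C f)) \<longrightarrow> R \<in> J X)"

text \<open>The smallest Grothendieck topology is constructed as an intersection; the lemmas
  \<open>regular_topology_grothendieck\<close>, \<open>regular_topology_generated_sieve\<close> and
  \<open>regular_topology_least\<close> below confirm that it is the least one.\<close>

definition regular_topology :: "('o, 'm) cat \<Rightarrow> 'o \<Rightarrow> 'm set set" where
  "regular_topology C X = {S. \<forall>J. grothendieck_topology C J \<longrightarrow>
     (\<forall>f. effective_epi C f \<longrightarrow> generated_sieve C f \<in> J (Cod C f)) \<longrightarrow> S \<in> J X}"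

text \<open>A presheaf of sets is given by its values \<open>F X\<close> and its restriction maps
  \<open>r f\<close> from \<open>F (Cod C f)\<close> to \<open>F (Dom C f)\<close>.\<close>

definition presheaf :: "('o, 'm) cat \<Rightarrow> ('o \<Rightarrow> 'a set) \<Rightarrow> ('m \<Rightarrow> 'a \<Rightarrow> 'a) \<Rightarrow> bool" where
  "presheaf C F r \<longleftrightarrow>
     (\<forall>f \<in> Ar C. \<forall>a \<in> F (Cod C f). r f a \<in> F (Dom C f)) \<and>
     (\<forall>X \<in> Ob C. \<forall>a \<in> F X. r (Id C X) a = a) \<and>
     (\<forall>f \<in> Ar C. \<forall>g \<in> Ar C. Cod C g = Dom C f \<longrightarrow>
        (\<forall>a \<in> F (Cod C f). r (f \<cdot>\<^bsub>C\<^esub> g) a = r g (r f a)))"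

definition matching_family ::
    "('o, 'm) cat \<Rightarrow> ('o \<Rightarrow> 'a set) \<Rightarrow> ('m \<Rightarrow> 'a \<Rightarrow> 'a) \<Rightarrow> 'm set \<Rightarrow> ('m \<Rightarrow> 'a) \<Rightarrow> bool" where
  "matching_family C F r S x \<longleftrightarrow>
     (\<forall>f \<in> S. x f \<in> F (Dom C f)) \<and>
     (\<forall>f \<in> S. \<forall>g \<in> Ar C. Cod C g = Dom C f \<longrightarrow> r g (x f) = x (f \<cdot>\<^bsub>C\<^esub> g))"

definition sheaf ::
    "('o, 'm) cat \<Rightarrow> ('o \<Rightarrow> 'm set set) \<Rightarrow> ('o \<Rightarrow> 'a set) \<Rightarrow> ('m \<Rightarrow> 'a \<Rightarrow> 'a) \<Rightarrow> bool" where
  "sheaf C J F r \<longleftrightarrow> presheaf C F r \<and>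
     (\<forall>X \<in> Ob C. \<forall>S \<in> J X. \<forall>x. matching_family C F r S x \<longrightarrow>
        (\<exists>!a. a \<in> F X \<and> (\<forall>f \<in> S. r f a = x f)))"

definition subcanonical :: "('o, 'm) cat \<Rightarrow> ('o \<Rightarrow> 'm set set) \<Rightarrow> bool" where
  "subcanonical C J \<longleftrightarrow>
     (\<forall>W \<in> Ob C. sheaf C J (\<lambda>X. Hom C X W) (\<lambda>f h. h \<cdot>\<^bsub>C\<^esub> f))"

lemma regular_topology_least:
  assumes "grothendieck_topology C J"
    and "\<And>f. effective_epi C f \<Longrightarrow> generated_sieve C f \<in> J (Cod C f)"
  shows "regular_topology C X \<subseteq> J X"
  using assms unfolding regular_topology_def by blast

lemma regular_topology_generated_sieve:
  "effective_epi C f \<Longrightarrow> generated_sieve C f \<in> regular_topology C (Cod C f)"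
  unfolding regular_topology_def by blast

context category
begin

lemma ArD: "f \<in> Ar C \<Longrightarrow> f \<in> Hom C (Dom C f) (Cod C f)"
  by (simp add: Hom_def)

lemma Comp_Ar:
  assumes "f \<in> Ar C" "g \<in> Ar C" "Cod C g = Dom C f"
  shows "f \<cdot> g \<in> Ar C" "Dom C (f \<cdot> g) = Dom C g" "Cod C (f \<cdot> g) = Cod C f"
proof -
  have "f \<cdot> g \<in> Hom C (Dom C g) (Cod C f)"
    using Comp_in_Hom[of g "Dom C g" "Dom C f" f "Cod C f"] assms by (simp add: Hom_def)
  then show "f \<cdot> g \<in> Ar C" "Dom C (f \<cdot> g) = Dom C g" "Cod C (f \<cdot> g) = Cod C f"
    by (simp_all add: Hom_def)
qed

lemma Comp_assoc_Ar:
  assumes "f \<in> Ar C" "g \<in> Ar C" "h \<in> Ar C" "Cod C g = Dom C f" "Cod C h = Dom C g"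
  shows "(f \<cdot> g) \<cdot> h = f \<cdot> (g \<cdot> h)"
  using Comp_assoc[of h "Dom C h" "Dom C g" g "Dom C f" f "Cod C f"] assms
  by (simp add: Hom_def)

lemma sieve_maximal: "sieve C X (maximal_sieve C X)"
  by (auto simp: sieve_def maximal_sieve_def Comp_Ar)

lemma sieve_pullback:
  assumes "f \<in> Ar C" "sieve C (Cod C f) S"
  shows "sieve C (Dom C f) (pullback_sieve C f S)"
proof -
  have "f \<cdot> (g \<cdot> h) \<in> S"
    if "g \<in> Ar C" "Cod C g = Dom C f" "f \<cdot> g \<in> S" "h \<in> Ar C" "Cod C h = Dom C g" for g h
  proof -
    have "(f \<cdot> g) \<cdot> h \<in> S"
      using that assms Comp_Ar[of f g] unfolding sieve_def by simp
    then show ?thesis using that assms Comp_assoc_Ar[of f g h] by simp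
  qed
  then show ?thesis
    by (auto simp: sieve_def pullback_sieve_def Comp_Ar)
qed

lemma grothendieck_topology_all_sieves:
  "grothendieck_topology C (\<lambda>X. {S. sieve C X S})"
  unfolding grothendieck_topology_def using sieve_maximal sieve_pullback by auto

lemma sieve_generated:
  assumes "f \<in> Ar C"
  shows "sieve C (Cod C f) (generated_sieve C f)"
  unfolding sieve_def generated_sieve_def
  using assms by (fastforce simp: Comp_Ar Comp_assoc_Ar)

lemma regular_topology_grothendieck: "grothendieck_topology C (regular_topology C)"
proof -
  let ?A = "\<lambda>J. grothendieck_topology C J \<and>
    (\<forall>f. effective_epi C f \<longrightarrow> generated_sieve C f \<in> J (Cod C f))"
  have R: "S \<in> regular_topology C X \<longleftrightarrow> (\<forall>J. ?A J \<longrightarrow> S \<in> J X)" for S X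
    unfolding regular_topology_def by blast
  have A: "?A (\<lambda>X. {S. sieve C X S})"
    using grothendieck_topology_all_sieves sieve_generated by (auto simp: effective_epi_def)
  have 1: "sieve C X S" if "S \<in> regular_topology C X" for X S
    using that A unfolding R by blast
  have 2: "maximal_sieve C X \<in> regular_topology C X" if "X \<in> Ob C" for X
    using that unfolding R grothendieck_topology_def by blast
  have 3: "pullback_sieve C f S \<in> regular_topology C (Dom C f)"
    if "f \<in> Ar C" "S \<in> regular_topology C (Cod C f)" for f S
    using that unfolding R grothendieck_topology_def by blast
  have 4: "Q \<in> regular_topology C X"
    if X: "X \<in> Ob C" and S: "S \<in> regular_topology C X" and Q: "sieve C X Q"
      and l: "\<forall>f \<in> S. pullback_sieve C f Q \<in> regular_topology C (Dom C f)" for X S Q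
    unfolding R
  proof (intro allI impI)
    fix J assume J: "?A J"
    have "S \<in> J X" using S J unfolding R by blast
    moreover have "\<forall>f \<in> S. pullback_sieve C f Q \<in> J (Dom C f)" using l J unfolding R by blast
    ultimately show "Q \<in> J X" using J X Q unfolding grothendieck_topology_def by blast
  qed
  show ?thesis
    unfolding grothendieck_topology_def[of C "regular_topology C"] using 1 2 3 4 by blast
qed

end

end

theory Submission
  imports Defs
begin

text \<open>
  For any presheaf \<open>F\<close>, call a sieve on \<open>X\<close> a \<^emph>\<open>universal gluing sieve\<close> if, after pullback along
  every morphism into \<open>X\<close>, matching families for \<open>F\<close> glue uniquely. These sieves form a Grothendieck
  topology (lemma \<open>grothendieck_topology_universal_gluing\<close>), and \<open>F\<close> is a sheaf for it by
  construction. The regular topology is the smallest one that contains the sieves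
  generated by effective epimorphisms. So it suffices to see that, for \<open>F = Hom(-,W)\<close>, those sieves are
  universal gluing sieves.

  Preregularity says that every pullback of the sieve generated by an effective epimorphism
  contains an effective epimorphism again. Hence the whole matter reduces to a sieve \<open>S\<close> that has
  an effective epimorphism \<open>h\<close> as a member (lemma \<open>representable_glues_if_effective_epi\<close>). Given a
  matching family \<open>x\<close> on \<open>S\<close>, the morphism \<open>x h\<close> does not distinguish two morphisms that \<open>h\<close> does not
  distinguish, so it factors uniquely as \<open>x h = d \<cdot> h\<close>. To see that \<open>d \<cdot> k = x k\<close> for an arbitrary
  \<open>k\<close> in \<open>S\<close>, cover \<open>k\<close> by \<open>h\<close>: preregularity gives an effective epimorphism \<open>h'\<close> and an \<open>i\<close> with
  \<open>h \<cdot> i = k \<cdot> h'\<close>, both sides agree after composition with \<open>h'\<close>, and \<open>h'\<close> is an epimorphism.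
\<close>

section \<open>Sieves along which a presheaf glues\<close>

definition glues ::
    "('o, 'm) cat \<Rightarrow> ('o \<Rightarrow> 'a set) \<Rightarrow> ('m \<Rightarrow> 'a \<Rightarrow> 'a) \<Rightarrow> 'o \<Rightarrow> 'm set \<Rightarrow> bool" where
  "glues C F r X S \<longleftrightarrow>
     (\<forall>x. matching_family C F r S x \<longrightarrow> (\<exists>!a. a \<in> F X \<and> (\<forall>f \<in> S. r f a = x f)))"

definition universal_gluing ::
    "('o, 'm) cat \<Rightarrow> ('o \<Rightarrow> 'a set) \<Rightarrow> ('m \<Rightarrow> 'a \<Rightarrow> 'a) \<Rightarrow> 'o \<Rightarrow> 'm set set" where
  "universal_gluing C F r X = {S. sieve C X S \<and>
     (\<forall>f \<in> Ar C. Cod C f = X \<longrightarrow> glues C F r (Dom C f) (pullback_sieve C f S))}"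

context category
begin

lemma Id_Ar:
  assumes "X \<in> Ob C"
  shows "Id C X \<in> Ar C" "Dom C (Id C X) = X" "Cod C (Id C X) = X"
  using Id_in_Hom[OF assms] by (auto simp: Hom_def)

lemma pullback_sieve_Id:
  assumes "X \<in> Ob C" "sieve C X S"
  shows "pullback_sieve C (Id C X) S = S"
proof -
  have "Id C X \<cdot> g = g" if "g \<in> Ar C" "Cod C g = X" for g
    using Comp_Id_left ArD that by blast
  then show ?thesis
    using assms by (auto simp: pullback_sieve_def sieve_def Id_Ar)
qed

lemma pullback_sieve_Comp:
  assumes "f \<in> Ar C" "g \<in> Ar C" "Cod C g = Dom C f"
  shows "pullback_sieve C (f \<cdot> g) S = pullback_sieve C g (pullback_sieve C f S)"
  using assms by (auto simp: pullback_sieve_def Comp_Ar Comp_assoc_Ar)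

lemma pullback_sieve_maximal:
  assumes "f \<in> Ar C" "Cod C f = X"
  shows "pullback_sieve C f (maximal_sieve C X) = maximal_sieve C (Dom C f)"
  using assms by (auto simp: pullback_sieve_def maximal_sieve_def Comp_Ar)

lemma universal_gluing_pullback:
  assumes f: "f \<in> Ar C" and S: "S \<in> universal_gluing C F r (Cod C f)"
  shows "pullback_sieve C f S \<in> universal_gluing C F r (Dom C f)"
proof -
  have "glues C F r (Dom C g) (pullback_sieve C g (pullback_sieve C f S))"
    if "g \<in> Ar C" "Cod C g = Dom C f" for g
  proof -
    have "glues C F r (Dom C (f \<cdot> g)) (pullback_sieve C (f \<cdot> g) S)"
      using S Comp_Ar[OF f that] unfolding universal_gluing_def by blast
    then show ?thesis
      using Comp_Ar[OF f that] pullback_sieve_Comp[OF f that, of S] by simp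
  qed
  then show ?thesis
    using S sieve_pullback[OF f] by (auto simp: universal_gluing_def)
qed

lemma universal_gluing_imp_glues:
  assumes "X \<in> Ob C" "S \<in> universal_gluing C F r X"
  shows "glues C F r X S"
proof -
  have S: "sieve C X S" using assms by (simp add: universal_gluing_def)
  have "glues C F r (Dom C (Id C X)) (pullback_sieve C (Id C X) S)"
    using assms Id_Ar[OF assms(1)] unfolding universal_gluing_def by blast
  then show ?thesis by (simp add: Id_Ar assms(1) pullback_sieve_Id[OF assms(1) S])
qed

lemma presheafD:
  assumes "presheaf C F r"
  shows presheaf_restrict: "f \<in> Ar C \<Longrightarrow> a \<in> F (Cod C f) \<Longrightarrow> r f a \<in> F (Dom C f)"
    and presheaf_Id: "X \<in> Ob C \<Longrightarrow> a \<in> F X \<Longrightarrow> r (Id C X) a = a"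
    and presheaf_Comp: "f \<in> Ar C \<Longrightarrow> g \<in> Ar C \<Longrightarrow> Cod C g = Dom C f \<Longrightarrow> a \<in> F (Cod C f) \<Longrightarrow>
      r (f \<cdot> g) a = r g (r f a)"
  using assms by (auto simp: presheaf_def)

text \<open>The restrictions of a section form a matching family, so unique gluing includes
  separatedness.\<close>

lemma glues_separated:
  assumes P: "presheaf C F r" and S: "sieve C X S" and g: "glues C F r X S"
    and a: "a \<in> F X" and b: "b \<in> F X" and eq: "\<And>f. f \<in> S \<Longrightarrow> r f a = r f b"
  shows "a = b"
proof -
  have "matching_family C F r S (\<lambda>f. r f a)"
    unfolding matching_family_def
  proof (intro conjI ballI impI)
    fix f assume "f \<in> S"
    then have f: "f \<in> Ar C" "Cod C f = X" using S by (auto simp: sieve_def)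
    show "r f a \<in> F (Dom C f)" using presheaf_restrict[OF P] f a by blast
    fix g assume "g \<in> Ar C" "Cod C g = Dom C f"
    then show "r g (r f a) = r (f \<cdot> g) a" using presheaf_Comp[OF P f(1)] f a by simp
  qed
  then have "\<exists>!c. c \<in> F X \<and> (\<forall>f\<in>S. r f c = r f a)"
    using g unfolding glues_def by blast
  then show ?thesis using a b eq by (metis (no_types, lifting))
qed

lemma glues_maximal:
  assumes P: "presheaf C F r" and X: "X \<in> Ob C"
  shows "glues C F r X (maximal_sieve C X)"
  unfolding glues_def
proof (intro allI impI)
  fix x assume x: "matching_family C F r (maximal_sieve C X) x"
  have idm: "Id C X \<in> maximal_sieve C X"
    using Id_Ar[OF X] by (simp add: maximal_sieve_def)
  \<comment> \<open>The glued section can only be the value of the family at the identity.\<close>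
  show "\<exists>!a. a \<in> F X \<and> (\<forall>f\<in>maximal_sieve C X. r f a = x f)"
  proof (rule ex1I[of _ "x (Id C X)"])
    have "r f (x (Id C X)) = x f" if "f \<in> maximal_sieve C X" for f
    proof -
      have f: "f \<in> Ar C" "Cod C f = X" using that by (auto simp: maximal_sieve_def)
      then have "Id C X \<cdot> f = f" using Comp_Id_left ArD by blast
      then show ?thesis using x idm f Id_Ar[OF X] unfolding matching_family_def by metis
    qed
    then show "x (Id C X) \<in> F X \<and> (\<forall>f\<in>maximal_sieve C X. r f (x (Id C X)) = x f)"
      using x idm Id_Ar[OF X] unfolding matching_family_def by metis
  next
    fix a assume "a \<in> F X \<and> (\<forall>f\<in>maximal_sieve C X. r f a = x f)"
    then show "a = x (Id C X)" using presheaf_Id[OF P X] idm by metis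
  qed
qed

section \<open>The topology of universal gluing sieves\<close>

text \<open>
  The transitivity axiom for a single sieve. A matching family \<open>x\<close> on \<open>R\<close> induces one on
  each pullback of \<open>R\<close> along a member \<open>f\<close> of \<open>S\<close>; it glues to a local section \<open>s f\<close>. The local sections
  match because each of them is determined by its restrictions, so they glue along \<open>S\<close>.
  That the result restricts to \<open>x f\<close> for \<open>f\<close> in \<open>R\<close>, where \<open>f\<close> need not lie in \<open>S\<close>, is tested on the
  pullback of \<open>S\<close> along \<open>f\<close>; this is where universality of \<open>S\<close> enters.
\<close>

lemma glues_transitive:
  assumes P: "presheaf C F r" and X: "X \<in> Ob C"
    and S: "S \<in> universal_gluing C F r X" and R: "sieve C X R"
    and local_gluing: "\<And>f. f \<in> S \<Longrightarrow> glues C F r (Dom C f) (pullback_sieve C f R)"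
  shows "glues C F r X R"
  unfolding glues_def
proof (intro allI impI)
  fix x assume x: "matching_family C F r R x"
  have sieveS: "sieve C X S" using S by (simp add: universal_gluing_def)
  have SD: "f \<in> Ar C" "Cod C f = X" if "f \<in> S" for f
    using that sieveS by (auto simp: sieve_def)
  have RD: "f \<in> Ar C" "Cod C f = X" if "f \<in> R" for f
    using that R by (auto simp: sieve_def)
  have Scomp: "f \<cdot> g \<in> S" if "f \<in> S" "g \<in> Ar C" "Cod C g = Dom C f" for f g
    using that sieveS by (auto simp: sieve_def)
  have xF: "x f \<in> F (Dom C f)" if "f \<in> R" for f
    using x that by (auto simp: matching_family_def)
  have xr: "r g (x f) = x (f \<cdot> g)" if "f \<in> R" "g \<in> Ar C" "Cod C g = Dom C f" for f g
    using x that by (auto simp: matching_family_def)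
  have local_separated: "a = b"
    if "f \<in> S" "a \<in> F (Dom C f)" "b \<in> F (Dom C f)"
      "\<And>g. g \<in> pullback_sieve C f R \<Longrightarrow> r g a = r g b" for f a b
    using glues_separated[OF P _ local_gluing] sieve_pullback[of f R] that SD R by metis

  have "\<exists>a. a \<in> F (Dom C f) \<and> (\<forall>g \<in> pullback_sieve C f R. r g a = x (f \<cdot> g))" if f: "f \<in> S" for f
  proof -
    have "matching_family C F r (pullback_sieve C f R) (\<lambda>g. x (f \<cdot> g))"
      unfolding matching_family_def pullback_sieve_def
    proof (intro conjI ballI impI; elim CollectE conjE)
      fix g assume g: "g \<in> Ar C" "Cod C g = Dom C f" "f \<cdot> g \<in> R"
      show "x (f \<cdot> g) \<in> F (Dom C g)"
        using xF[OF g(3)] Comp_Ar[of f g] SD[OF f] g by simp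
      fix h assume h: "h \<in> Ar C" "Cod C h = Dom C g"
      show "r h (x (f \<cdot> g)) = x (f \<cdot> (g \<cdot> h))"
        using xr[OF g(3), of h] Comp_Ar[of f g] Comp_assoc_Ar[of f g h] SD[OF f] g h by simp
    qed
    then show ?thesis using local_gluing[OF f] unfolding glues_def by blast
  qed
  then obtain s where sF: "\<And>f. f \<in> S \<Longrightarrow> s f \<in> F (Dom C f)"
    and sr: "\<And>f g. f \<in> S \<Longrightarrow> g \<in> pullback_sieve C f R \<Longrightarrow> r g (s f) = x (f \<cdot> g)"
    by metis

  have "r g (s f) = s (f \<cdot> g)" if f: "f \<in> S" and g: "g \<in> Ar C" "Cod C g = Dom C f" for f g
  proof (rule local_separated[OF Scomp[OF f g]])
    note fg = Comp_Ar[OF SD(1)[OF f] g]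
    show "r g (s f) \<in> F (Dom C (f \<cdot> g))"
      using presheaf_restrict[OF P g(1)] sF[OF f] g fg by simp
    show "s (f \<cdot> g) \<in> F (Dom C (f \<cdot> g))"
      using sF[OF Scomp[OF f g]] .
    fix h assume h: "h \<in> pullback_sieve C (f \<cdot> g) R"
    then have h': "h \<in> Ar C" "Cod C h = Dom C g" "g \<cdot> h \<in> pullback_sieve C f R"
      using fg SD[OF f] g Comp_Ar[of g h] Comp_assoc_Ar[of f g h]
      by (auto simp: pullback_sieve_def)
    have "r h (r g (s f)) = r (g \<cdot> h) (s f)"
      using presheaf_Comp[OF P g(1) h'(1,2)] sF[OF f] g by simp
    also have "\<dots> = x ((f \<cdot> g) \<cdot> h)"
      using sr[OF f h'(3)] Comp_assoc_Ar[of f g h] SD[OF f] g h' by simp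
    also have "\<dots> = r h (s (f \<cdot> g))"
      using sr[OF Scomp[OF f g] h] by simp
    finally show "r h (r g (s f)) = r h (s (f \<cdot> g))" .
  qed
  then have "matching_family C F r S s"
    using sF by (simp add: matching_family_def)
  then obtain a where a: "a \<in> F X" and ar: "\<And>f. f \<in> S \<Longrightarrow> r f a = s f"
    using universal_gluing_imp_glues[OF X S] unfolding glues_def by blast

  have s_eq_x: "s f = x f" if f: "f \<in> S" "f \<in> R" for f
  proof -
    have D: "Dom C f \<in> Ob C" using SD[OF f(1)] Dom_in_Ob by blast
    have fid: "f \<cdot> Id C (Dom C f) = f" using Comp_Id_right ArD SD[OF f(1)] by blast
    have "Id C (Dom C f) \<in> pullback_sieve C f R"
      using f fid Id_Ar[OF D] by (simp add: pullback_sieve_def)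
    from sr[OF f(1) this] show ?thesis
      using presheaf_Id[OF P D] sF[OF f(1)] fid by simp
  qed
  have a_restrict: "r f a = x f" if f: "f \<in> R" for f
  proof (rule glues_separated[OF P, where X = "Dom C f" and S = "pullback_sieve C f S"])
    show "sieve C (Dom C f) (pullback_sieve C f S)"
      using sieve_pullback RD[OF f] sieveS by blast
    show "glues C F r (Dom C f) (pullback_sieve C f S)"
      using S RD[OF f] by (simp add: universal_gluing_def)
    show "r f a \<in> F (Dom C f)" using presheaf_restrict[OF P] RD[OF f] a by blast
    show "x f \<in> F (Dom C f)" using xF[OF f] .
    fix g assume "g \<in> pullback_sieve C f S"
    then have g: "g \<in> Ar C" "Cod C g = Dom C f" "f \<cdot> g \<in> S"
      by (auto simp: pullback_sieve_def)
    have "f \<cdot> g \<in> R" using f g R by (auto simp: sieve_def)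
    then have "s (f \<cdot> g) = x (f \<cdot> g)" using s_eq_x g by blast
    then show "r g (r f a) = r g (x f)"
      using presheaf_Comp[OF P _ g(1,2)] RD[OF f] a ar[OF g(3)] xr[OF f g(1,2)] by metis
  qed
  show "\<exists>!a. a \<in> F X \<and> (\<forall>f\<in>R. r f a = x f)"
  proof (rule ex1I[of _ a])
    show "a \<in> F X \<and> (\<forall>f\<in>R. r f a = x f)" using a a_restrict by blast
  next
    fix b assume b: "b \<in> F X \<and> (\<forall>f\<in>R. r f b = x f)"
    show "b = a"
    proof (rule glues_separated[OF P sieveS universal_gluing_imp_glues[OF X S]])
      show "b \<in> F X" "a \<in> F X" using a b by auto
      fix f assume f: "f \<in> S"
      show "r f b = r f a"
      proof (rule local_separated[OF f])
        show "r f b \<in> F (Dom C f)" "r f a \<in> F (Dom C f)"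
          using presheaf_restrict[OF P] SD[OF f] a b by auto
        fix g assume "g \<in> pullback_sieve C f R"
        then have g: "g \<in> Ar C" "Cod C g = Dom C f" "f \<cdot> g \<in> R"
          by (auto simp: pullback_sieve_def)
        then show "r g (r f b) = r g (r f a)"
          using presheaf_Comp[OF P _ g(1,2)] SD[OF f] a b a_restrict by metis
      qed
    qed
  qed
qed

text \<open>Unique gluing on \<open>S\<close> alone need not be stable under pullback. Quantifying over all pullbacks
  repairs this, and since the hypotheses of the transitivity axiom are themselves stable under
  pullback, that axiom reduces to \<open>glues_transitive\<close>.\<close>

lemma grothendieck_topology_universal_gluing:
  assumes P: "presheaf C F r"
  shows "grothendieck_topology C (universal_gluing C F r)"
  unfolding grothendieck_topology_def
proof (intro conjI ballI allI impI)
  fix X S assume "X \<in> Ob C" "S \<in> universal_gluing C F r X"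
  then show "sieve C X S" by (simp add: universal_gluing_def)
next
  fix X assume "X \<in> Ob C"
  then show "maximal_sieve C X \<in> universal_gluing C F r X"
    using sieve_maximal pullback_sieve_maximal glues_maximal[OF P] Dom_in_Ob
    by (simp add: universal_gluing_def)
next
  fix f S assume "f \<in> Ar C" "S \<in> universal_gluing C F r (Cod C f)"
  then show "pullback_sieve C f S \<in> universal_gluing C F r (Dom C f)"
    by (rule universal_gluing_pullback)
next
  fix X S R assume X: "X \<in> Ob C" and S: "S \<in> universal_gluing C F r X" and R: "sieve C X R"
    and loc: "\<forall>f\<in>S. pullback_sieve C f R \<in> universal_gluing C F r (Dom C f)"
  have "glues C F r (Dom C k) (pullback_sieve C k R)" if k: "k \<in> Ar C" "Cod C k = X" for k
  proof (rule glues_transitive[OF P])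
    show "Dom C k \<in> Ob C" using k Dom_in_Ob by blast
    show "pullback_sieve C k S \<in> universal_gluing C F r (Dom C k)"
      using universal_gluing_pullback k S by blast
    show "sieve C (Dom C k) (pullback_sieve C k R)"
      using sieve_pullback k R by blast
    fix f assume "f \<in> pullback_sieve C k S"
    then have f: "f \<in> Ar C" "Cod C f = Dom C k" "k \<cdot> f \<in> S"
      by (auto simp: pullback_sieve_def)
    note kf = Comp_Ar[OF k(1) f(1,2)]
    have "glues C F r (Dom C (k \<cdot> f)) (pullback_sieve C (k \<cdot> f) R)"
      using universal_gluing_imp_glues loc f(3) kf Dom_in_Ob by blast
    then show "glues C F r (Dom C f) (pullback_sieve C f (pullback_sieve C k R))"
      using pullback_sieve_Comp[OF k(1) f(1,2), of R] kf by simp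
  qed
  then show "R \<in> universal_gluing C F r X"
    using R by (simp add: universal_gluing_def)
qed

section \<open>Representable presheaves and effective epimorphisms\<close>

lemma presheaf_representable: "presheaf C (\<lambda>X. Hom C X W) (\<lambda>f h. h \<cdot> f)"
  unfolding presheaf_def
proof (intro conjI ballI impI)
  fix f a assume "f \<in> Ar C" "a \<in> Hom C (Cod C f) W"
  then show "a \<cdot> f \<in> Hom C (Dom C f) W" using Comp_in_Hom ArD by blast
next
  fix X a assume "X \<in> Ob C" "a \<in> Hom C X W"
  then show "a \<cdot> Id C X = a" using Comp_Id_right by blast
next
  fix f g a assume "f \<in> Ar C" "g \<in> Ar C" "Cod C g = Dom C f" "a \<in> Hom C (Cod C f) W"
  then show "a \<cdot> (f \<cdot> g) = (a \<cdot> f) \<cdot> g"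
    using Comp_assoc_Ar[of a f g] by (simp add: Hom_def)
qed

text \<open>The morphism \<open>d \<cdot> f\<close> identifies whatever \<open>f\<close> identifies, and the factorization through \<open>f\<close>
  is unique.\<close>

lemma effective_epi_cancel:
  assumes f: "effective_epi C f" and d: "d \<in> Hom C (Cod C f) W" "d' \<in> Hom C (Cod C f) W"
    and eq: "d \<cdot> f = d' \<cdot> f"
  shows "d = d'"
proof -
  have fA: "f \<in> Ar C" using f by (simp add: effective_epi_def)
  have W: "W \<in> Ob C" using d(1) Cod_in_Ob by (auto simp: Hom_def)
  have e: "d \<cdot> f \<in> Hom C (Dom C f) W" using Comp_in_Hom[OF ArD[OF fA] d(1)] .
  have "(d \<cdot> f) \<cdot> g1 = (d \<cdot> f) \<cdot> g2"
    if "g1 \<in> Hom C Z (Dom C f)" "g2 \<in> Hom C Z (Dom C f)" "f \<cdot> g1 = f \<cdot> g2" for Z g1 g2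
    using Comp_assoc[OF that(1) ArD[OF fA] d(1)] Comp_assoc[OF that(2) ArD[OF fA] d(1)] that(3)
    by simp
  then have "\<exists>!c. c \<in> Hom C (Cod C f) W \<and> c \<cdot> f = d \<cdot> f"
    using f W e unfolding effective_epi_def by blast
  then show ?thesis using d eq by metis
qed

end

context preregular_category
begin

lemma representable_glues_if_effective_epi:
  assumes W: "W \<in> Ob C" and S: "sieve C X S" and h: "effective_epi C h" "h \<in> S"
  shows "glues C (\<lambda>X. Hom C X W) (\<lambda>f h. h \<cdot> f) X S"
  unfolding glues_def
proof (intro allI impI)
  fix x assume x: "matching_family C (\<lambda>X. Hom C X W) (\<lambda>f h. h \<cdot> f) S x"
  have SD: "f \<in> Ar C" "Cod C f = X" if "f \<in> S" for f
    using that S by (auto simp: sieve_def)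
  note hX = SD[OF h(2)]
  have xF: "x f \<in> Hom C (Dom C f) W" if "f \<in> S" for f
    using x that by (auto simp: matching_family_def)
  have xr: "x f \<cdot> g = x (f \<cdot> g)" if "f \<in> S" "g \<in> Hom C Z (Dom C f)" for f g Z
    using x that by (auto simp: matching_family_def Hom_def)
  have "x h \<cdot> g1 = x h \<cdot> g2"
    if "g1 \<in> Hom C Z (Dom C h)" "g2 \<in> Hom C Z (Dom C h)" "h \<cdot> g1 = h \<cdot> g2" for Z g1 g2
    using xr[OF h(2)] that by metis
  then have "\<exists>!d. d \<in> Hom C (Cod C h) W \<and> d \<cdot> h = x h"
    using h W xF unfolding effective_epi_def by blast
  then obtain d where d: "d \<in> Hom C X W" "d \<cdot> h = x h" using hX by blast
  have "d \<cdot> k = x k" if k: "k \<in> S" for k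
  proof -
    note kX = SD[OF k]
    have hH: "h \<in> Hom C (Dom C h) X" and kH: "k \<in> Hom C (Dom C k) X"
      using hX kX by (auto simp: Hom_def)
    obtain V h' i where h': "h' \<in> Hom C V (Dom C k)" "effective_epi C h'"
      and i: "i \<in> Hom C V (Dom C h)" and sq: "h \<cdot> i = k \<cdot> h'"
      using preregular[OF h(1) hH kH] by blast
    have "(d \<cdot> k) \<cdot> h' = (d \<cdot> h) \<cdot> i"
      using Comp_assoc[OF h'(1) kH d(1)] Comp_assoc[OF i hH d(1)] sq by simp
    also have "\<dots> = x k \<cdot> h'"
      using d(2) xr[OF h(2) i] xr[OF k h'(1)] sq by simp
    finally have eq: "(d \<cdot> k) \<cdot> h' = x k \<cdot> h'" .
    show ?thesis
      using effective_epi_cancel[OF h'(2) _ _ eq] Comp_in_Hom[OF kH d(1)] xF[OF k] h'(1)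
      by (simp add: Hom_def)
  qed
  then show "\<exists>!a. a \<in> Hom C X W \<and> (\<forall>f\<in>S. a \<cdot> f = x f)"
    using d effective_epi_cancel[OF h(1)] hX h(2) by metis
qed

text \<open>Preregularity turns the pullback of the sieve generated by \<open>f\<close> into a sieve with
  an effective epimorphism among its members.\<close>

lemma generated_sieve_universal_gluing:
  assumes W: "W \<in> Ob C" and f: "effective_epi C f"
  shows "generated_sieve C f \<in> universal_gluing C (\<lambda>X. Hom C X W) (\<lambda>f h. h \<cdot> f) (Cod C f)"
proof -
  have fA: "f \<in> Ar C" using f by (simp add: effective_epi_def)
  have "glues C (\<lambda>X. Hom C X W) (\<lambda>f h. h \<cdot> f) (Dom C k)
      (pullback_sieve C k (generated_sieve C f))"
    if k: "k \<in> Ar C" "Cod C k = Cod C f" for k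
  proof -
    obtain V h i where h: "h \<in> Hom C V (Dom C k)" "effective_epi C h"
      and i: "i \<in> Hom C V (Dom C f)" and sq: "f \<cdot> i = k \<cdot> h"
      using preregular[OF f ArD[OF fA], of k "Dom C k"] ArD[OF k(1)] k(2) by auto
    have "f \<cdot> i \<in> generated_sieve C f"
      using i by (auto simp: generated_sieve_def Hom_def)
    then have "h \<in> pullback_sieve C k (generated_sieve C f)"
      using h sq by (simp add: pullback_sieve_def Hom_def)
    then show ?thesis
      using representable_glues_if_effective_epi[OF W _ h(2)] sieve_pullback[OF k(1)]
        sieve_generated[OF fA] k(2) by metis
  qed
  then show ?thesis using sieve_generated[OF fA] by (simp add: universal_gluing_def)
qed

end

theorem proposition6p1:
  fixes C :: "('o, 'm) cat"
  assumes "preregular_category C"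
  shows "subcanonical C (regular_topology C)"
proof -
  interpret preregular_category C by fact
  show ?thesis
    unfolding subcanonical_def
  proof
    fix W assume W: "W \<in> Ob C"
    let ?F = "\<lambda>X. Hom C X W" and ?r = "\<lambda>f h. h \<cdot>\<^bsub>C\<^esub> f"
    have "regular_topology C X \<subseteq> universal_gluing C ?F ?r X" for X
      by (rule regular_topology_least[OF
            grothendieck_topology_universal_gluing[OF presheaf_representable]
            generated_sieve_universal_gluing[OF W]])
    then have "glues C ?F ?r X S" if "X \<in> Ob C" "S \<in> regular_topology C X" for X S
      using universal_gluing_imp_glues[OF that(1)] that(2) by (meson subsetD)
    then show "sheaf C (regular_topology C) ?F ?r"
      unfolding sheaf_def glues_def by (simp add: presheaf_representable)
  qed
qed

end
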